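(* Let $\Omega$ be an arbitrary non-empty set, $\mathcal{E}\subseteq\mathcal{P}(\Omega)$ an arbitrary non-empty family of events, and $P:\mathcal{E}\to[0,1]$ a probability assessment (i.e. an arbitrary function). Then the following statements are equivalent: (i) $P$ is coherent-1P; (ii) $P$ is coherent-2P; (iii) $P$ is coherent-3P; (iv) $P$ is coherent-4P; (v) $P$ is coherent-5P.
   Context: $\mathcal{P}(\Omega)$ is the power set of $\Omega$; $\mathbf{1}_A:\Omega\to\{0,1\}$ is the indicator of $A$. For a non-empty family $\mathcal{G}\subseteq\mathcal{P}(\Omega)$, $\mathcal{A}_{\mathcal{G}}$ denotes the minimal algebra of subsets of $\Omega$ containing $\mathcal{G}$, and $\mathcal{U}_{\mathcal{G}}=\mathcal{A}_{\mathcal{G}}\setminus\{\emptyset\}$. For $A\in\mathcal{A}_{\mathcal{G}}$ let $\tilde{A}=\{B\in\mathcal{U}_{\mathcal{G}}:B\subseteq A\}\subseteq\mathcal{U}_{\mathcal{G}}$, and let $\mathfrak{A}_{\mathcal{G}}$ be the minimal algebra of subsets of $\mathcal{U}_{\mathcal{G}}$ containing $\{\tilde{A}:A\in\mathcal{U}_{\mathcal{G}}\}$. For finite non-empty $\mathcal{F}$, $\mathcal{C}_{\mathcal{F}}$ denotes the set of atoms of the finite algebra $\mathcal{A}_{\mathcal{F}}$ (the finest partition of $\Omega$ contained in $\mathcal{A}_{\mathcal{F}}$). For $B\ne\emptyset$ and an event $E$, $\min_{\omega\in B}\mathbf{1}_E(\omega)$ equals $1$ if $B\subseteq E$ and $0$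 otherwise. A probability assessment $P:\mathcal{E}\to[0,1]$ is called: - coherent-1P if there is a finitely additive probability $P':\mathcal{A}_{\mathcal{E}}\to[0,1]$ with $P(E)=P'(E)$ for every $E\in\mathcal{E}$; - coherent-2P if there is a finitely additive probability $\mu:\mathfrak{A}_{\mathcal{E}}\to[0,1]$ such that the mapping $A\mapsto\mu(\tilde{A})$, $A\in\mathcal{A}_{\mathcal{E}}$, is a finitely additive probability and, for every $E\in\mathcal{E}$, $P(E)=\int_{\mathcal{U}_{\mathcal{E}}}\big(\min_{\omega\in B}\mathbf{1}_E(\omega)\big)\,\mu(\mathrm{d}B)$ (Stieltjes-type integral with respect to a finitely additive measure); - coherent-3P if, for every $n\in\mathbb{N}$ and every $\mathcal{F}=\{E_1,\dots,E_n\}\subseteq\mathcal{E}$, the following linear system in the unknowns $x_C$, $C\in\mathcal{C}_{\mathcal{F}}$, has a solution: $\sum_{C\in\mathcal{C}_{\mathcal{F}}}\big(\min_{\omega\in C}\mathbf{1}_{E_i}(\omega)\big)x_C=P(E_i)$ for $i=1,\dots,n$; $\sum_{C\in\mathcal{C}_{\mathcal{F}}}x_C=1$; $x_C\ge 0$ for every $C\in\mathcal{C}_{\mathcal{F}}$; - coherent-4P if, for every $n\in\mathbb{N}$, every $\mathcal{F}=\{E_1,\dots,E_n\}\subseteq\mathcal{E}$ and every $\lambda_1,\dots,\lambda_n\in\mathbb{R}$, the function $G_{\mathcal{F}}:\mathcal{C}_{\mathcal{F}}\to\mathbb{R}$, $G_{\mathcal{F}}(C)=\sum_{i=1}^n\lambda_i\big(\min_{\omega\in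 C}\mathbf{1}_{E_i}(\omega)-P(E_i)\big)$, satisfies $\max_{C\in\mathcal{C}_{\mathcal{F}}}G_{\mathcal{F}}(C)\ge 0$; - coherent-5P if, for every $n\in\mathbb{N}$ and every $\mathcal{F}=\{E_1,\dots,E_n\}\subseteq\mathcal{E}$, there is no assessment $P^*:\mathcal{F}\to[0,1]$ distinct from the restriction of $P$ to $\mathcal{F}$ such that the functions $L^*_{\mathcal{F}},L_{\mathcal{F}}:\mathcal{C}_{\mathcal{F}}\to\mathbb{R}$, $L^*_{\mathcal{F}}(C)=\sum_{i=1}^n\big(\min_{\omega\in C}\mathbf{1}_{E_i}(\omega)-P^*(E_i)\big)^2$ and $L_{\mathcal{F}}(C)=\sum_{i=1}^n\big(\min_{\omega\in C}\mathbf{1}_{E_i}(\omega)-P(E_i)\big)^2$, satisfy $L^*_{\mathcal{F}}(C)<L_{\mathcal{F}}(C)$ for every $C\in\mathcal{C}_{\mathcal{F}}$. *)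

theory Defs
  imports "HOL-Analysis.Analysis"
begin

definition gen_algebra :: "'a set \<Rightarrow> 'a set set \<Rightarrow> 'a set set" where
  "gen_algebra \<Omega> G = algebra \<Omega> hull G"

definition nonempty_events :: "'a set \<Rightarrow> 'a set set \<Rightarrow> 'a set set" where
  "nonempty_events \<Omega> G = gen_algebra \<Omega> G - {{}}"

definition tilde :: "'a set \<Rightarrow> 'a set set \<Rightarrow> 'a set \<Rightarrow> 'a set set" where
  "tilde \<Omega> G A = {B \<in> nonempty_events \<Omega> G. B \<subseteq> A}"

definition tilde_algebra :: "'a set \<Rightarrow> 'a set set \<Rightarrow> 'a set set set" where
  "tilde_algebra \<Omega> G =
     gen_algebra (nonempty_events \<Omega> G) (tilde \<Omega> G ` nonempty_events \<Omega> G)"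

definition atoms :: "'a set \<Rightarrow> 'a set set \<Rightarrow> 'a set set" where
  "atoms \<Omega> F =
     {C \<in> gen_algebra \<Omega> F. C \<noteq> {} \<and> (\<forall>B\<in>gen_algebra \<Omega> F. B \<subseteq> C \<longrightarrow> B = {} \<or> B = C)}"

lemma algebra_gen_algebra:
  assumes "G \<subseteq> Pow \<Omega>"
  shows "algebra \<Omega> (gen_algebra \<Omega> G)"
proof -
  have "algebra \<Omega> (Pow \<Omega>)"
    by (auto simp: algebra_iff_Un)
  then have sub: "gen_algebra \<Omega> G \<subseteq> Pow \<Omega>"
    unfolding gen_algebra_def using assms by (rule hull_minimal[rotated])
  have alg: "{} \<in> M" "A \<in> M \<Longrightarrow> \<Omega> - A \<in> M" "A \<in> M \<Longrightarrow> B \<in> M \<Longrightarrow> A \<union> B \<in> M"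
    if "algebra \<Omega> M" for M A B
    using that by (simp_all add: algebra_iff_Un)
  show ?thesis
    using sub by (simp add: algebra_iff_Un) (simp add: gen_algebra_def hull_def alg)
qed

lemma gen_algebra_superset: "G \<subseteq> gen_algebra \<Omega> G"
  unfolding gen_algebra_def by (rule hull_subset)

lemma gen_algebra_minimal:
  "algebra \<Omega> M \<Longrightarrow> G \<subseteq> M \<Longrightarrow> gen_algebra \<Omega> G \<subseteq> M"
  unfolding gen_algebra_def by (rule hull_minimal)

definition fin_add_prob :: "'a set \<Rightarrow> 'a set set \<Rightarrow> ('a set \<Rightarrow> real) \<Rightarrow> bool" where
  "fin_add_prob S M \<mu> \<longleftrightarrow> \<mu> \<in> M \<rightarrow> {0..1} \<and> \<mu> S = 1 \<and> additive M \<mu>"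

definition fin_partitions :: "'a set \<Rightarrow> 'a set set \<Rightarrow> 'a set set set" where
  "fin_partitions S M = {\<P>. finite \<P> \<and> \<P> \<subseteq> M \<and> partition_on S \<P>}"

text \<open>
  The integral of a bounded function with respect to a finitely additive \<open>\<mu>\<close> on an algebra
  \<open>M\<close> of subsets of \<open>S\<close>, in the Darboux form: the infimum of the upper sums and the supremum
  of the lower sums over the finite \<open>M\<close>-partitions of \<open>S\<close> agree.
  Boundedness makes the suprema and infima below genuine (for \<open>S \<noteq> {}\<close>).
\<close>

definition has_stieltjes_integral ::
  "'a set \<Rightarrow> 'a set set \<Rightarrow> ('a set \<Rightarrow> real) \<Rightarrow> ('a \<Rightarrow> real) \<Rightarrow> real \<Rightarrow> bool" where
  "has_stieltjes_integral S M \<mu> f I \<longleftrightarrow>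
     bounded (f ` S) \<and>
     (INF \<P>\<in>fin_partitions S M. \<Sum>A\<in>\<P>. (SUP x\<in>A. f x) * \<mu> A) = I \<and>
     (SUP \<P>\<in>fin_partitions S M. \<Sum>A\<in>\<P>. (INF x\<in>A. f x) * \<mu> A) = I"

definition min_ind :: "'a set \<Rightarrow> 'a set \<Rightarrow> real" where
  "min_ind E B = (MIN \<omega>\<in>B. indicat_real E \<omega>)"

lemma min_ind_eq:
  assumes "B \<noteq> {}"
  shows "min_ind E B = (if B \<subseteq> E then 1 else 0)"
proof -
  have fin: "finite (indicat_real E ` B)"
    by (rule finite_subset[of _ "{0, 1}"]) (auto simp: indicator_def)
  show ?thesis
  proof (cases "B \<subseteq> E")
    case True
    then have "indicat_real E ` B = {1}"
      using assms by (auto simp: indicator_def image_iff subset_iff)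
    then show ?thesis
      using True by (simp add: min_ind_def)
  next
    case False
    then have "0 \<in> indicat_real E ` B"
      by (auto simp: indicator_def image_iff)
    then have "Min (indicat_real E ` B) = 0"
      by (intro Min_eqI fin) auto
    then show ?thesis
      using False by (simp add: min_ind_def)
  qed
qed

definition coherent_1P :: "'a set \<Rightarrow> 'a set set \<Rightarrow> ('a set \<Rightarrow> real) \<Rightarrow> bool" where
  "coherent_1P \<Omega> \<E> P \<longleftrightarrow>
     (\<exists>P'. fin_add_prob \<Omega> (gen_algebra \<Omega> \<E>) P' \<and> (\<forall>E\<in>\<E>. P E = P' E))"

definition coherent_2P :: "'a set \<Rightarrow> 'a set set \<Rightarrow> ('a set \<Rightarrow> real) \<Rightarrow> bool" where
  "coherent_2P \<Omega> \<E> P \<longleftrightarrow>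
     (\<exists>\<mu>. fin_add_prob (nonempty_events \<Omega> \<E>) (tilde_algebra \<Omega> \<E>) \<mu> \<and>
          fin_add_prob \<Omega> (gen_algebra \<Omega> \<E>) (\<lambda>A. \<mu> (tilde \<Omega> \<E> A)) \<and>
          (\<forall>E\<in>\<E>. has_stieltjes_integral (nonempty_events \<Omega> \<E>) (tilde_algebra \<Omega> \<E>) \<mu>
                     (\<lambda>B. min_ind E B) (P E)))"

text \<open>
  In the next three definitions a finite family of \<open>n \<ge> 1\<close> distinct events
  \<open>E\<^sub>1, \<dots>, E\<^sub>n\<close> is represented by the set \<open>F\<close> of its members, and sequences indexed by
  \<open>1, \<dots>, n\<close> by functions on \<open>F\<close>.
\<close>

definition coherent_3P :: "'a set \<Rightarrow> 'a set set \<Rightarrow> ('a set \<Rightarrow> real) \<Rightarrow> bool" where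
  "coherent_3P \<Omega> \<E> P \<longleftrightarrow>
     (\<forall>F. finite F \<and> F \<noteq> {} \<and> F \<subseteq> \<E> \<longrightarrow>
       (\<exists>x. (\<forall>E\<in>F. (\<Sum>C\<in>atoms \<Omega> F. min_ind E C * x C) = P E) \<and>
            (\<Sum>C\<in>atoms \<Omega> F. x C) = 1 \<and>
            (\<forall>C\<in>atoms \<Omega> F. x C \<ge> 0)))"

definition coherent_4P :: "'a set \<Rightarrow> 'a set set \<Rightarrow> ('a set \<Rightarrow> real) \<Rightarrow> bool" where
  "coherent_4P \<Omega> \<E> P \<longleftrightarrow>
     (\<forall>F (l :: 'a set \<Rightarrow> real). finite F \<and> F \<noteq> {} \<and> F \<subseteq> \<E> \<longrightarrow>
       (MAX C\<in>atoms \<Omega> F. \<Sum>E\<in>F. l E * (min_ind E C - P E)) \<ge> 0)"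

definition quadratic_loss :: "'a set set \<Rightarrow> ('a set \<Rightarrow> real) \<Rightarrow> 'a set \<Rightarrow> real" where
  "quadratic_loss F Q C = (\<Sum>E\<in>F. (min_ind E C - Q E)\<^sup>2)"

definition coherent_5P :: "'a set \<Rightarrow> 'a set set \<Rightarrow> ('a set \<Rightarrow> real) \<Rightarrow> bool" where
  "coherent_5P \<Omega> \<E> P \<longleftrightarrow>
     (\<forall>F. finite F \<and> F \<noteq> {} \<and> F \<subseteq> \<E> \<longrightarrow>
       \<not> (\<exists>Q. Q \<in> F \<rightarrow> {0..1} \<and> (\<exists>E\<in>F. Q E \<noteq> P E) \<and>
             (\<forall>C\<in>atoms \<Omega> F. quadratic_loss F Q C < quadratic_loss F P C)))"

end

theory Submission
  imports Defs
begin

text \<open>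
  The map \<open>B \<mapsto> min\<^sub>B 1\<^sub>E\<close> is the indicator of the class of non-empty events below \<open>E\<close>, so its
  integral is the measure of that class; hence (ii) gives (i). Conversely, map a class \<open>X\<close> of
  events to the set of points \<open>\<omega>\<close> having a neighbourhood \<open>A\<close> in the algebra such that every
  smaller neighbourhood of \<open>\<omega>\<close> lies in \<open>X\<close>. On the classes in question this is a homomorphism
  of algebras that recovers \<open>E\<close> from its class; composing a probability with it gives \<open>\<mu>\<close>.

  A probability restricted to the atoms solves (iii), and averaging gains, or differences of
  losses, with the weights of (iii) excludes a sure loss (iv) and dominance (v). For the
  converses, the finitely additive probabilities on the power set form a compact convex set,
  so there is one, \<open>q\<close>, whose restriction to a given finite family is nearest to \<open>P\<close> in the
  quadratic distance. If \<open>q\<close> differs from \<open>P\<close> there, its variational inequality shows that the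
  stakes \<open>P - q\<close> lose surely and that \<open>q\<close> dominates \<open>P\<close>. So under (iv) or (v) every finite
  restriction of \<open>P\<close> extends, and compactness gives a common extension.
\<close>

subsection \<open>Finitely additive probabilities\<close>

lemma fin_add_prob_empty:
  assumes "fin_add_prob S M \<mu>" "{} \<in> M"
  shows "\<mu> {} = 0"
  using additiveD[of M \<mu> "{}" "{}"] assms by (simp add: fin_add_prob_def)

lemma fin_add_prob_sum:
  assumes alg: "algebra S M" and \<mu>: "fin_add_prob S M \<mu>"
    and "finite I" "A ` I \<subseteq> M" "disjoint_family_on A I"
  shows "(\<Sum>i\<in>I. \<mu> (A i)) = \<mu> (\<Union>i\<in>I. A i)"
  using assms(3-5)
proof (induction I)
  case empty
  interpret algebra S M by fact
  show ?case using fin_add_prob_empty[OF \<mu>] by simp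
next
  case (insert i I)
  interpret algebra S M by fact
  have "A i \<inter> (\<Union>j\<in>I. A j) = {}"
    using insert.prems(2) insert.hyps(2) by (auto simp: disjoint_family_on_def)
  moreover have "(\<Union>j\<in>I. A j) \<in> M"
    using insert.prems(1) insert.hyps(1) by (intro finite_UN) auto
  ultimately have "\<mu> (A i \<union> (\<Union>j\<in>I. A j)) = \<mu> (A i) + \<mu> (\<Union>j\<in>I. A j)"
    using \<mu> insert.prems(1) by (intro additiveD[of M]) (auto simp: fin_add_prob_def)
  moreover have "disjoint_family_on A I"
    using insert.prems(2) by (auto simp: disjoint_family_on_def)
  ultimately show ?case using insert by simp
qed

lemma fin_add_prob_subset:
  assumes "fin_add_prob S M \<mu>" "N \<subseteq> M"
  shows "fin_add_prob S N \<mu>"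
  using assms unfolding fin_add_prob_def additive_def by blast

lemma fin_add_prob_partition:
  assumes alg: "algebra S M" and \<mu>: "fin_add_prob S M \<mu>"
    and A: "A \<in> M" and \<P>: "\<P> \<in> fin_partitions S M"
  shows "\<mu> A = (\<Sum>B\<in>\<P>. \<mu> (B \<inter> A))"
proof -
  interpret algebra S M by fact
  have "\<mu> (\<Union>B\<in>\<P>. B \<inter> A) = \<mu> A"
    using \<P> sets_into_space[OF A]
    by (intro arg_cong[where f = \<mu>]) (auto simp: fin_partitions_def partition_on_def)
  moreover have "disjoint_family_on (\<lambda>B. B \<inter> A) \<P>"
    using \<P> by (auto simp: fin_partitions_def partition_on_def disjoint_family_on_def disjoint_def)
  moreover have "finite \<P>" "(\<lambda>B. B \<inter> A) ` \<P> \<subseteq> M"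
    using \<P> A by (auto simp: fin_partitions_def)
  ultimately show ?thesis
    using fin_add_prob_sum[OF alg \<mu>, of \<P> "\<lambda>B. B \<inter> A"] by simp
qed

lemma fin_add_prob_mono:
  assumes alg: "algebra S M" and \<mu>: "fin_add_prob S M \<mu>"
    and A: "A \<in> M" "B \<in> M" "A \<subseteq> B"
  shows "\<mu> A \<le> \<mu> B"
proof -
  interpret algebra S M by fact
  have "\<mu> (A \<union> (B - A)) = \<mu> A + \<mu> (B - A)"
    using \<mu> A by (intro additiveD[of M]) (auto simp: fin_add_prob_def)
  moreover have "A \<union> (B - A) = B" "0 \<le> \<mu> (B - A)"
    using \<mu> A by (auto simp: fin_add_prob_def)
  ultimately show ?thesis by simp
qed

section \<open>The Darboux integral of an indicator\<close>

lemma cSUP_indicator: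
  assumes "B \<noteq> {}" "\<And>x. x \<in> B \<Longrightarrow> f x = indicat_real A x"
  shows "(SUP x\<in>B. f x) = (if B \<inter> A = {} then 0 else 1)"
  using assms by (intro cSup_eq_maximum) (auto simp: image_iff indicator_def)

lemma cINF_indicator:
  assumes "B \<noteq> {}" "\<And>x. x \<in> B \<Longrightarrow> f x = indicat_real A x"
  shows "(INF x\<in>B. f x) = (if B \<subseteq> A then 1 else 0)"
  using assms by (intro cInf_eq_minimum) (auto simp: image_iff indicator_def)

text \<open>In any finite partition the blocks that meet \<open>A\<close> cover \<open>A\<close>,
  and the blocks inside \<open>A\<close> are covered by it. So upper sums are at least
  \<open>\<mu> A\<close>, lower sums at most \<open>\<mu> A\<close>, and one partition attains both
  bounds.\<close>

lemma has_stieltjes_integral_indicator_iff: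
  assumes alg: "algebra S M" and \<mu>: "fin_add_prob S M \<mu>" and A: "A \<in> M"
    and f: "\<And>x. x \<in> S \<Longrightarrow> f x = indicat_real A x"
  shows "has_stieltjes_integral S M \<mu> f I \<longleftrightarrow> I = \<mu> A"
proof -
  interpret algebra S M by fact
  have \<mu>0: "\<mu> {} = 0" using fin_add_prob_empty[OF \<mu>] by simp
  have nonneg: "0 \<le> \<mu> B" if "B \<in> M" for B using \<mu> that by (auto simp: fin_add_prob_def)
  define U where "U \<P> = (\<Sum>B\<in>\<P>. (SUP x\<in>B. f x) * \<mu> B)" for \<P>
  define L where "L \<P> = (\<Sum>B\<in>\<P>. (INF x\<in>B. f x) * \<mu> B)" for \<P>
  have SUP_eq: "(SUP x\<in>B. f x) = (if B \<inter> A = {} then 0 else 1)"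
    and INF_eq: "(INF x\<in>B. f x) = (if B \<subseteq> A then 1 else 0)"
    if "B \<in> \<P>" "\<P> \<in> fin_partitions S M" for B \<P>
  proof -
    have "B \<noteq> {}" "B \<subseteq> S" using that by (auto simp: fin_partitions_def partition_on_def)
    then show "(SUP x\<in>B. f x) = (if B \<inter> A = {} then 0 else 1)"
      and "(INF x\<in>B. f x) = (if B \<subseteq> A then 1 else 0)"
      using f by (intro cSUP_indicator cINF_indicator; auto)+
  qed
  have U_ge: "\<mu> A \<le> U \<P>" and L_le: "L \<P> \<le> \<mu> A" if \<P>: "\<P> \<in> fin_partitions S M" for \<P>
  proof -
    have inM: "B \<in> M" if "B \<in> \<P>" for B using that \<P> by (auto simp: fin_partitions_def)
    have mono: "\<mu> (B \<inter> A) \<le> \<mu> B" if "B \<in> \<P>" for B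
      using inM[OF that] A by (intro fin_add_prob_mono[OF alg \<mu>]) auto
    have "(\<Sum>B\<in>\<P>. \<mu> (B \<inter> A)) \<le> U \<P>"
      unfolding U_def using mono \<mu>0 by (intro sum_mono) (auto simp: SUP_eq[OF _ \<P>])
    moreover have "L \<P> \<le> (\<Sum>B\<in>\<P>. \<mu> (B \<inter> A))"
      unfolding L_def using inM A
      by (intro sum_mono) (auto simp: INF_eq[OF _ \<P>] Int_absorb2 intro!: nonneg)
    ultimately show "\<mu> A \<le> U \<P>" "L \<P> \<le> \<mu> A"
      by (simp_all add: fin_add_prob_partition[OF alg \<mu> A \<P>])
  qed
  \<comment> \<open>The partition into \<open>A\<close> and its complement makes \<open>f\<close>
    constant on each block. The empty set is removed because blocks of a partition are non-empty and
    \<open>A\<close> may be \<open>{}\<close> or \<open>S\<close>.\<close>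
  define \<Q> where "\<Q> = {A, S - A} - {{}}"
  have \<Q>: "\<Q> \<in> fin_partitions S M"
    using A sets_into_space[OF A]
    by (auto simp: \<Q>_def fin_partitions_def partition_on_def disjoint_def)
  have cases: "B = A \<and> B \<noteq> {} \<or> B = S - A \<and> B \<inter> A = {} \<and> \<not> B \<subseteq> A" if "B \<in> \<Q>" for B
    using that by (auto simp: \<Q>_def)
  have "(SUP x\<in>B. f x) * \<mu> B = \<mu> (B \<inter> A)" "(INF x\<in>B. f x) * \<mu> B = \<mu> (B \<inter> A)"
    if "B \<in> \<Q>" for B
    using cases[OF that] SUP_eq[OF that \<Q>] INF_eq[OF that \<Q>] \<mu>0 by auto
  then have U\<Q>: "U \<Q> = \<mu> A" and L\<Q>: "L \<Q> = \<mu> A"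
    unfolding U_def L_def by (simp_all add: fin_add_prob_partition[OF alg \<mu> A \<Q>])
  have "(INF \<P>\<in>fin_partitions S M. U \<P>) = \<mu> A"
    using U_ge imageI[OF \<Q>, of U] U\<Q> by (intro cInf_eq_minimum) auto
  moreover have "(SUP \<P>\<in>fin_partitions S M. L \<P>) = \<mu> A"
    using L_le imageI[OF \<Q>, of L] L\<Q> by (intro cSup_eq_maximum) auto
  moreover have "bounded (f ` S)"
    by (rule bounded_subset[OF finite_imp_bounded[of "{0, 1}"]]) (auto simp: f indicator_def)
  ultimately show ?thesis
    unfolding has_stieltjes_integral_def U_def L_def by auto
qed

subsection \<open>The algebra of classes of non-empty events\<close>

text \<open>\<open>M\<close> plays the role of a base of neighbourhoods.\<close>

definition germ :: "'a set \<Rightarrow> 'a set set \<Rightarrow> 'a set set \<Rightarrow> 'a set" where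
  "germ \<Omega> M X = {\<omega> \<in> \<Omega>. \<exists>A\<in>M. \<omega> \<in> A \<and> (\<forall>B\<in>M. \<omega> \<in> B \<longrightarrow> B \<subseteq> A \<longrightarrow> B \<in> X)}"

lemma germI:
  "\<omega> \<in> \<Omega> \<Longrightarrow> A \<in> M \<Longrightarrow> \<omega> \<in> A \<Longrightarrow> (\<And>B. B \<in> M \<Longrightarrow> \<omega> \<in> B \<Longrightarrow> B \<subseteq> A \<Longrightarrow> B \<in> X)
    \<Longrightarrow> \<omega> \<in> germ \<Omega> M X"
  unfolding germ_def by blast

lemma germE:
  assumes "\<omega> \<in> germ \<Omega> M X"
  obtains A where "\<omega> \<in> \<Omega>" "A \<in> M" "\<omega> \<in> A"
    "\<And>B. B \<in> M \<Longrightarrow> \<omega> \<in> B \<Longrightarrow> B \<subseteq> A \<Longrightarrow> B \<in> X"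
  using assms unfolding germ_def by blast

lemma germ_subset: "germ \<Omega> M X \<subseteq> \<Omega>"
  by (auto simp: germ_def)

lemma germ_mono: "X \<subseteq> Y \<Longrightarrow> germ \<Omega> M X \<subseteq> germ \<Omega> M Y"
  unfolding germ_def by blast

text \<open>The intersection of two witnessing neighbourhoods is again one: for a fixed point of
  \<open>\<Omega>\<close>, the classes \<open>X\<close> whose germ contains it form a
  filter.\<close>

lemma germ_Int:
  assumes "algebra \<Omega> M"
  shows "germ \<Omega> M (X \<inter> Y) = germ \<Omega> M X \<inter> germ \<Omega> M Y"
proof -
  interpret algebra \<Omega> M by fact
  have "\<omega> \<in> germ \<Omega> M (X \<inter> Y)" if \<omega>: "\<omega> \<in> germ \<Omega> M X" "\<omega> \<in> germ \<Omega> M Y" for \<omega>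
  proof -
    from \<omega>(1) obtain A where A: "\<omega> \<in> \<Omega>" "A \<in> M" "\<omega> \<in> A"
      "\<And>C. C \<in> M \<Longrightarrow> \<omega> \<in> C \<Longrightarrow> C \<subseteq> A \<Longrightarrow> C \<in> X" by (rule germE) blast
    from \<omega>(2) obtain B where B: "\<omega> \<in> \<Omega>" "B \<in> M" "\<omega> \<in> B"
      "\<And>C. C \<in> M \<Longrightarrow> \<omega> \<in> C \<Longrightarrow> C \<subseteq> B \<Longrightarrow> C \<in> Y" by (rule germE) blast
    show ?thesis
      using A(1-3) B(1-3) by (intro germI[of \<omega> \<Omega> "A \<inter> B"]) (simp_all add: Int A(4) B(4))
  qed
  then show ?thesis
    using germ_mono[of "X \<inter> Y" X \<Omega> M] germ_mono[of "X \<inter> Y" Y \<Omega> M] by blast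
qed

lemma germ_empty: "germ \<Omega> M {} = {}"
  by (auto simp: germ_def)

lemma germ_nonempty_events:
  assumes "algebra \<Omega> M"
  shows "germ \<Omega> M (M - {{}}) = \<Omega>"
proof -
  interpret algebra \<Omega> M by fact
  show ?thesis
    using germ_subset[of \<Omega> M "M - {{}}"] by (blast intro: germI[of _ _ \<Omega>])
qed

text \<open>At a point of \<open>A\<close> the set \<open>A\<close> itself is the witness, at any
  other point \<open>\<Omega> - A\<close> is, since its non-empty subsets are not below
  \<open>A\<close>. The two germs are disjoint, so these inclusions are equalities.\<close>

lemma germ_tilde:
  assumes "algebra \<Omega> M" and A: "A \<in> M"
  defines "T \<equiv> {B \<in> M - {{}}. B \<subseteq> A}"
  shows "germ \<Omega> M T = A" and "germ \<Omega> M (M - {{}} - T) = \<Omega> - A"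
proof -
  interpret algebra \<Omega> M by fact
  note A\<Omega> = sets_into_space[OF A]
  have compl: "\<Omega> - A \<in> M" using A by blast
  have in_T: "\<omega> \<in> germ \<Omega> M T" if "\<omega> \<in> A" for \<omega>
    using that A A\<Omega> by (intro germI[of \<omega> \<Omega> A]) (auto simp: T_def)
  have in_compl: "\<omega> \<in> germ \<Omega> M (M - {{}} - T)" if "\<omega> \<in> \<Omega> - A" for \<omega>
    using that compl by (intro germI[of \<omega> \<Omega> "\<Omega> - A"]) (auto simp: T_def)
  have "germ \<Omega> M T \<inter> germ \<Omega> M (M - {{}} - T) = {}"
    by (simp add: germ_empty flip: germ_Int[OF assms(1)])
  with in_T in_compl show "germ \<Omega> M T = A" "germ \<Omega> M (M - {{}} - T) = \<Omega> - A"
    using germ_subset[of \<Omega> M T] germ_subset[of \<Omega> M "M - {{}} - T"] A\<Omega> by blast+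
qed

text \<open>In general a point may lie in neither the germ of \<open>X\<close> nor that of its
  complement. The classes that every point decides are closed under the algebra operations, which is
  what makes induction over a generated algebra possible.\<close>

lemma algebra_germ_decided:
  assumes alg: "algebra \<Omega> M"
  defines "U \<equiv> M - {{}}"
  shows "algebra U {X. X \<subseteq> U \<and> germ \<Omega> M X \<in> M \<and> germ \<Omega> M (U - X) = \<Omega> - germ \<Omega> M X}"
    (is "algebra U ?D")
proof -
  interpret algebra \<Omega> M by fact
  show ?thesis unfolding algebra_iff_Int
  proof (intro conjI ballI)
    show "{} \<in> ?D"
      using germ_nonempty_events[OF alg] by (simp add: U_def germ_empty)
    show "U - X \<in> ?D" if "X \<in> ?D" for X
      using that germ_subset[of \<Omega> M X] by (auto simp: double_diff)
    show "X \<inter> Y \<in> ?D" if "X \<in> ?D" "Y \<in> ?D" for X Y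
    proof -
      \<comment> \<open>By assumption the left side is the complement of
        \<open>germ \<Omega> M X \<inter> germ \<Omega> M Y\<close>, and disjointness below gives
        the reverse inclusion.\<close>
      have "germ \<Omega> M (U - X) \<union> germ \<Omega> M (U - Y) \<subseteq> germ \<Omega> M (U - X \<inter> Y)"
        by (intro Un_least germ_mono) auto
      moreover have "germ \<Omega> M (U - X \<inter> Y) \<inter> germ \<Omega> M (X \<inter> Y) = {}"
        unfolding germ_Int[OF alg, symmetric]
        by (simp add: Diff_disjoint[of "X \<inter> Y" U] Int_commute germ_empty)
      ultimately show ?thesis
        using that germ_subset[of \<Omega> M "U - X \<inter> Y"] by (auto simp: germ_Int[OF alg])
    qed
  qed auto
qed

text \<open>The generators are decided by all points, so minimality of the generated algebra extends
  this to all its members.\<close>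

lemma tilde_algebra_germ:
  assumes "\<E> \<subseteq> Pow \<Omega>" "X \<in> tilde_algebra \<Omega> \<E>"
  defines "M \<equiv> gen_algebra \<Omega> \<E>" and "U \<equiv> nonempty_events \<Omega> \<E>"
  shows "germ \<Omega> M X \<in> M" and "germ \<Omega> M (U - X) = \<Omega> - germ \<Omega> M X"
proof -
  have alg: "algebra \<Omega> M" unfolding M_def by (rule algebra_gen_algebra[OF assms(1)])
  have U: "U = M - {{}}" by (simp add: U_def M_def nonempty_events_def)
  have tilde: "tilde \<Omega> \<E> A = {B \<in> M - {{}}. B \<subseteq> A}" for A
    by (simp add: tilde_def M_def nonempty_events_def)
  have "tilde_algebra \<Omega> \<E>
      \<subseteq> {X. X \<subseteq> U \<and> germ \<Omega> M X \<in> M \<and> germ \<Omega> M (U - X) = \<Omega> - germ \<Omega> M X}"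
    unfolding tilde_algebra_def U_def[symmetric]
  proof (rule gen_algebra_minimal)
    show "algebra U {X. X \<subseteq> U \<and> germ \<Omega> M X \<in> M \<and> germ \<Omega> M (U - X) = \<Omega> - germ \<Omega> M X}"
      unfolding U by (rule algebra_germ_decided[OF alg])
    have "tilde \<Omega> \<E> A \<subseteq> U \<and> germ \<Omega> M (tilde \<Omega> \<E> A) \<in> M
        \<and> germ \<Omega> M (U - tilde \<Omega> \<E> A) = \<Omega> - germ \<Omega> M (tilde \<Omega> \<E> A)" if "A \<in> U" for A
    proof -
      have A: "A \<in> M" using that U by simp
      show ?thesis unfolding U tilde germ_tilde[OF alg A] using A by auto
    qed
    then show "tilde \<Omega> \<E> ` U \<subseteq> {X. X \<subseteq> U \<and> germ \<Omega> M X \<in> M \<and> germ \<Omega> M (U - X) = \<Omega> - germ \<Omega> M X}"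
      by blast
  qed
  with assms(2) show "germ \<Omega> M X \<in> M" "germ \<Omega> M (U - X) = \<Omega> - germ \<Omega> M X" by auto
qed

section \<open>Measures on classes of events; equivalence of (i) and (ii)\<close>

lemma algebra_tilde_algebra: "algebra (nonempty_events \<Omega> \<E>) (tilde_algebra \<Omega> \<E>)"
  unfolding tilde_algebra_def by (rule algebra_gen_algebra) (auto simp: tilde_def)

lemma tilde_in_tilde_algebra:
  assumes "A \<in> gen_algebra \<Omega> \<E>"
  shows "tilde \<Omega> \<E> A \<in> tilde_algebra \<Omega> \<E>"
\<comment> \<open>The generators come from non-empty events only, so the class of \<open>{}\<close>
  needs its own argument.\<close>
proof (cases "A = {}")
  case True
  interpret algebra "nonempty_events \<Omega> \<E>" "tilde_algebra \<Omega> \<E>" by (rule algebra_tilde_algebra)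
  have "tilde \<Omega> \<E> A = {}" using True by (auto simp: tilde_def nonempty_events_def)
  then show ?thesis by simp
next
  case False
  with assms show ?thesis
    unfolding tilde_algebra_def
    using gen_algebra_superset[of "tilde \<Omega> \<E> ` nonempty_events \<Omega> \<E>"]
    by (auto simp: nonempty_events_def)
qed

lemma min_ind_integral_iff:
  assumes "fin_add_prob (nonempty_events \<Omega> \<E>) (tilde_algebra \<Omega> \<E>) \<mu>" "E \<in> \<E>"
  shows "has_stieltjes_integral (nonempty_events \<Omega> \<E>) (tilde_algebra \<Omega> \<E>) \<mu> (min_ind E) I
    \<longleftrightarrow> I = \<mu> (tilde \<Omega> \<E> E)"
  using assms gen_algebra_superset[of \<E> \<Omega>]
  by (intro has_stieltjes_integral_indicator_iff algebra_tilde_algebra tilde_in_tilde_algebra)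
     (auto simp: min_ind_eq nonempty_events_def tilde_def indicator_def)

lemma coherent_2P_imp_1P: "coherent_2P \<Omega> \<E> P \<Longrightarrow> coherent_1P \<Omega> \<E> P"
  unfolding coherent_1P_def coherent_2P_def using min_ind_integral_iff by blast

lemma coherent_1P_imp_2P:
  assumes \<E>: "\<E> \<subseteq> Pow \<Omega>" and "coherent_1P \<Omega> \<E> P"
  shows "coherent_2P \<Omega> \<E> P"
proof -
  let ?M = "gen_algebra \<Omega> \<E>" and ?U = "nonempty_events \<Omega> \<E>" and ?T = "tilde_algebra \<Omega> \<E>"
  note alg = algebra_gen_algebra[OF \<E>]
  from assms(2) obtain p where p: "fin_add_prob \<Omega> ?M p" and Pp: "\<And>E. E \<in> \<E> \<Longrightarrow> P E = p E"
    by (auto simp: coherent_1P_def)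
  interpret T: algebra ?U ?T by (rule algebra_tilde_algebra)
  define \<mu> where "\<mu> X = p (germ \<Omega> ?M X)" for X
  have \<mu>_tilde: "\<mu> (tilde \<Omega> \<E> A) = p A" if "A \<in> ?M" for A
    using germ_tilde(1)[OF alg that] by (simp add: \<mu>_def tilde_def nonempty_events_def)
  note compl = tilde_algebra_germ(2)[OF \<E>]
  have germ_Un: "germ \<Omega> ?M (X \<union> Y) = germ \<Omega> ?M X \<union> germ \<Omega> ?M Y" if "X \<in> ?T" "Y \<in> ?T" for X Y
  proof -
    \<comment> \<open>The germ map respects intersections, and on this algebra also complements;
      unions follow by De Morgan.\<close>
    have "X \<union> Y = ?U - ((?U - X) \<inter> (?U - Y))"
      using that[THEN T.sets_into_space] by auto
    then have "germ \<Omega> ?M (X \<union> Y) = \<Omega> - germ \<Omega> ?M ((?U - X) \<inter> (?U - Y))"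
      using that by (simp only: compl) (auto intro!: compl)
    also have "\<dots> = \<Omega> - (\<Omega> - germ \<Omega> ?M X) \<inter> (\<Omega> - germ \<Omega> ?M Y)"
      using that by (simp add: germ_Int[OF alg] compl)
    also have "\<dots> = germ \<Omega> ?M X \<union> germ \<Omega> ?M Y" by (auto simp: germ_def)
    finally show ?thesis .
  qed
  have "additive ?T \<mu>"
    unfolding additive_def
  proof (intro ballI impI)
    fix X Y assume XY: "X \<in> ?T" "Y \<in> ?T" "X \<inter> Y = {}"
    have "germ \<Omega> ?M X \<inter> germ \<Omega> ?M Y = {}"
      using XY by (simp add: germ_empty flip: germ_Int[OF alg])
    then show "\<mu> (X \<union> Y) = \<mu> X + \<mu> Y"
      using p tilde_algebra_germ(1)[OF \<E>] XY
      by (simp add: \<mu>_def germ_Un fin_add_prob_def additive_def)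
  qed
  then have \<mu>: "fin_add_prob ?U ?T \<mu>"
    using p tilde_algebra_germ(1)[OF \<E>] germ_nonempty_events[OF alg]
    by (auto simp: fin_add_prob_def \<mu>_def nonempty_events_def)
  interpret algebra \<Omega> ?M by (rule alg)
  have "fin_add_prob \<Omega> ?M (\<lambda>A. \<mu> (tilde \<Omega> \<E> A))"
    using p by (auto simp: fin_add_prob_def additive_def \<mu>_tilde Pi_iff Un)
  moreover have "\<forall>E\<in>\<E>. has_stieltjes_integral ?U ?T \<mu> (\<lambda>B. min_ind E B) (P E)"
    using min_ind_integral_iff[OF \<mu>] gen_algebra_superset[of \<E> \<Omega>] by (auto simp: \<mu>_tilde Pp)
  ultimately show ?thesis using \<mu> unfolding coherent_2P_def by blast
qed

subsection \<open>Atoms\<close>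

text \<open>Give each point the signature \<open>{E \<in> F. \<omega> \<in> E}\<close>. The sets
  \<open>?h \<S>\<close> of points with signature in \<open>\<S>\<close> form an algebra containing
  \<open>F\<close>, and there are finitely many choices of \<open>\<S>\<close>.\<close>

lemma finite_gen_algebra:
  assumes "F \<subseteq> Pow \<Omega>" "finite F"
  shows "finite (gen_algebra \<Omega> F)"
proof -
  let ?h = "\<lambda>\<S>. {\<omega> \<in> \<Omega>. {E \<in> F. \<omega> \<in> E} \<in> \<S>}"
  have "algebra \<Omega> (?h ` Pow (Pow F))"
    unfolding algebra_iff_Un
  proof (intro conjI ballI)
    show "{} \<in> ?h ` Pow (Pow F)" by (auto intro!: image_eqI[of _ _ "{}"])
    fix A assume "A \<in> ?h ` Pow (Pow F)"
    then obtain \<S> where \<S>: "\<S> \<subseteq> Pow F" "A = ?h \<S>" by auto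
    have "\<Omega> - A = ?h (Pow F - \<S>)" using \<S> by auto
    then show "\<Omega> - A \<in> ?h ` Pow (Pow F)" by blast
    fix B assume "B \<in> ?h ` Pow (Pow F)"
    then obtain \<T> where \<T>: "\<T> \<subseteq> Pow F" "B = ?h \<T>" by auto
    have "A \<union> B = ?h (\<S> \<union> \<T>)" using \<S> \<T> by auto
    then show "A \<union> B \<in> ?h ` Pow (Pow F)" using \<S> \<T> by blast
  qed auto
  moreover have "F \<subseteq> ?h ` Pow (Pow F)"
  proof
    fix E assume "E \<in> F"
    then have "E = ?h {\<A> \<in> Pow F. E \<in> \<A>}" using assms by auto
    then show "E \<in> ?h ` Pow (Pow F)" by blast
  qed
  ultimately have "gen_algebra \<Omega> F \<subseteq> ?h ` Pow (Pow F)" by (rule gen_algebra_minimal)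
  then show ?thesis using assms(2) by (auto intro: finite_subset)
qed

lemma atom_subset_or_disjoint:
  assumes "F \<subseteq> Pow \<Omega>" "C \<in> atoms \<Omega> F" "A \<in> gen_algebra \<Omega> F"
  shows "C \<subseteq> A \<or> C \<inter> A = {}"
proof -
  interpret algebra \<Omega> "gen_algebra \<Omega> F" using assms(1) by (rule algebra_gen_algebra)
  have "C \<inter> A \<in> gen_algebra \<Omega> F" using assms by (auto simp: atoms_def)
  then show ?thesis using assms(2) by (auto simp: atoms_def)
qed

lemma atoms_fin_partitions:
  assumes F: "F \<subseteq> Pow \<Omega>" "finite F"
  shows "atoms \<Omega> F \<in> fin_partitions \<Omega> (gen_algebra \<Omega> F)"
proof -
  interpret algebra \<Omega> "gen_algebra \<Omega> F" using F(1) by (rule algebra_gen_algebra)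
  have sub: "atoms \<Omega> F \<subseteq> gen_algebra \<Omega> F" by (auto simp: atoms_def)
  have "\<exists>C\<in>atoms \<Omega> F. \<omega> \<in> C" if "\<omega> \<in> \<Omega>" for \<omega>
  proof (intro bexI)
    let ?N = "{A \<in> gen_algebra \<Omega> F. \<omega> \<in> A}"
    \<comment> \<open>The atom around \<open>\<omega>\<close> is the least member of the algebra
      containing it; finiteness keeps the intersection in the algebra.\<close>
    let ?C = "\<Inter>A\<in>?N. A"
    have fin: "finite ?N" using finite_gen_algebra[OF F] by auto
    show \<omega>: "\<omega> \<in> ?C" by auto
    have C: "?C \<in> gen_algebra \<Omega> F"
      using that fin by (intro finite_INT) auto
    have "B = {} \<or> B = ?C" if B: "B \<in> gen_algebra \<Omega> F" "B \<subseteq> ?C" for B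
    proof (cases "\<omega> \<in> B")
      case True
      then show ?thesis using B by blast
    next
      case False
      \<comment> \<open>Minimality of \<open>?C\<close> then gives
        \<open>?C \<subseteq> ?C - B\<close>, so \<open>B\<close> is empty.\<close>
      then have "?C - B \<in> ?N" using C B \<omega> by blast
      then show ?thesis using B by blast
    qed
    then show "?C \<in> atoms \<Omega> F" using C \<omega> unfolding atoms_def by blast
  qed
  then have "\<Union>(atoms \<Omega> F) = \<Omega>"
    using sub space_closed by blast
  moreover have "disjoint (atoms \<Omega> F)"
    unfolding disjoint_def
  proof (intro ballI impI)
    fix C D assume CD: "C \<in> atoms \<Omega> F" "D \<in> atoms \<Omega> F" "C \<noteq> D"
    then show "C \<inter> D = {}"
      using atom_subset_or_disjoint[OF F(1), of C D] atom_subset_or_disjoint[OF F(1), of D C] sub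
      by blast
  qed
  ultimately show ?thesis
    using sub finite_subset[OF sub finite_gen_algebra[OF F]]
    by (auto simp: fin_partitions_def partition_on_def atoms_def)
qed

text \<open>Each event of \<open>F\<close> contains an atom or misses it, so its indicator is
  constant there and any point may represent the atom.\<close>

lemma min_ind_atom:
  assumes "F \<subseteq> Pow \<Omega>" "C \<in> atoms \<Omega> F" "E \<in> F" "\<omega> \<in> C"
  shows "min_ind E C = indicat_real E \<omega>"
proof -
  have "E \<in> gen_algebra \<Omega> F" using gen_algebra_superset assms(3) by blast
  moreover have "C \<noteq> {}" using assms(4) by blast
  ultimately show ?thesis
    using atom_subset_or_disjoint[OF assms(1,2), of E] assms(4)
    by (auto simp: min_ind_eq indicator_def)
qed

lemma atoms_finite_nonempty:
  assumes "\<Omega> \<noteq> {}" "F \<subseteq> Pow \<Omega>" "finite F"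
  shows "finite (atoms \<Omega> F)" "atoms \<Omega> F \<noteq> {}"
  using atoms_fin_partitions[OF assms(2,3)] assms(1)
  by (auto simp: fin_partitions_def partition_on_def)

section \<open>From a probability to weights on the atoms\<close>

lemma coherent_1P_imp_3P:
  assumes \<E>: "\<E> \<subseteq> Pow \<Omega>" and "coherent_1P \<Omega> \<E> P"
  shows "coherent_3P \<Omega> \<E> P"
  unfolding coherent_3P_def
proof (intro allI impI)
  fix F assume F: "finite F \<and> F \<noteq> {} \<and> F \<subseteq> \<E>"
  then have F': "F \<subseteq> Pow \<Omega>" using \<E> by auto
  let ?N = "gen_algebra \<Omega> F"
  note algF = algebra_gen_algebra[OF F']
  interpret algebra \<Omega> ?N by (rule algF)
  from assms(2) obtain p where p': "fin_add_prob \<Omega> (gen_algebra \<Omega> \<E>) p"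
    and Pp: "\<And>E. E \<in> \<E> \<Longrightarrow> P E = p E"
    by (auto simp: coherent_1P_def)
  have p: "fin_add_prob \<Omega> ?N p"
  proof (rule fin_add_prob_subset[OF p'])
    have "F \<subseteq> gen_algebra \<Omega> \<E>" using F gen_algebra_superset[of \<E> \<Omega>] by blast
    then show "?N \<subseteq> gen_algebra \<Omega> \<E>" by (rule gen_algebra_minimal[OF algebra_gen_algebra[OF \<E>]])
  qed
  have part: "atoms \<Omega> F \<in> fin_partitions \<Omega> ?N" using atoms_fin_partitions[OF F'] F by auto
  have p0: "p {} = 0" using fin_add_prob_empty[OF p] by auto
  have "(\<Sum>C\<in>atoms \<Omega> F. min_ind E C * p C) = P E" if "E \<in> F" for E
  proof -
    have E: "E \<in> ?N" using that gen_algebra_superset by blast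
    have "p E = (\<Sum>C\<in>atoms \<Omega> F. p (C \<inter> E))"
      by (rule fin_add_prob_partition[OF algF p E part])
    also have "\<dots> = (\<Sum>C\<in>atoms \<Omega> F. min_ind E C * p C)"
    proof (rule sum.cong)
      fix C assume C: "C \<in> atoms \<Omega> F"
      then have "C \<noteq> {}" by (auto simp: atoms_def)
      then show "p (C \<inter> E) = min_ind E C * p C"
        using atom_subset_or_disjoint[OF F' C E] p0 by (auto simp: min_ind_eq Int_absorb2)
    qed simp
    finally show ?thesis using Pp F that by auto
  qed
  moreover have "(\<Sum>C\<in>atoms \<Omega> F. p C) = 1"
  proof -
    have "p \<Omega> = (\<Sum>C\<in>atoms \<Omega> F. p (C \<inter> \<Omega>))"
      by (rule fin_add_prob_partition[OF algF p top part])
    also have "\<dots> = (\<Sum>C\<in>atoms \<Omega> F. p C)"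
      by (rule sum.cong) (simp_all add: atoms_def)
    finally show ?thesis using p by (simp add: fin_add_prob_def)
  qed
  moreover have "\<forall>C\<in>atoms \<Omega> F. p C \<ge> 0"
    using p by (auto simp: fin_add_prob_def atoms_def)
  ultimately show "\<exists>x. (\<forall>E\<in>F. (\<Sum>C\<in>atoms \<Omega> F. min_ind E C * x C) = P E) \<and>
      (\<Sum>C\<in>atoms \<Omega> F. x C) = 1 \<and> (\<forall>C\<in>atoms \<Omega> F. x C \<ge> 0)"
    by blast
qed

subsection \<open>Averaging over the atoms\<close>

text \<open>Weights summing to 1 include a positive one, so averaging negative values would give a
  negative result.\<close>

lemma ex_nonneg_of_average_nonneg:
  fixes g x :: "'b \<Rightarrow> real"
  assumes "finite A" "sum x A = 1" "\<And>C. C \<in> A \<Longrightarrow> 0 \<le> x C" "0 \<le> (\<Sum>C\<in>A. x C * g C)"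
  shows "\<exists>C\<in>A. 0 \<le> g C"
proof (rule ccontr)
  assume "\<not> ?thesis"
  then have neg: "g C < 0" if "C \<in> A" for C using that by force
  obtain D where D: "D \<in> A" "0 < x D"
    using assms(2,3) by (metis less_eq_real_def sum.neutral zero_neq_one)
  have "(\<Sum>C\<in>A. x C * g C) < (\<Sum>C\<in>A. 0)"
    using D neg assms(1,3)
    by (intro sum_strict_mono_ex1) (auto simp: mult_le_0_iff mult_less_0_iff less_imp_le)
  then show False using assms(4) by simp
qed

text \<open>Linearity of expectation: replacing each \<open>v E\<close> by its mean
  \<open>P E\<close> evaluates any affine combination. Gains and differences of quadratic losses
  both have this form.\<close>

lemma average_affine:
  fixes v :: "'c \<Rightarrow> 'b \<Rightarrow> real"
  assumes "sum x A = 1" "\<And>E. E \<in> F \<Longrightarrow> (\<Sum>C\<in>A. v E C * x C) = P E"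
  shows "(\<Sum>C\<in>A. x C * (\<Sum>E\<in>F. a E * v E C + b E)) = (\<Sum>E\<in>F. a E * P E + b E)"
proof -
  have "(\<Sum>C\<in>A. x C * (\<Sum>E\<in>F. a E * v E C + b E))
      = (\<Sum>E\<in>F. \<Sum>C\<in>A. a E * (v E C * x C) + b E * x C)"
    unfolding sum_distrib_left by (subst sum.swap) (simp add: algebra_simps)
  also have "\<dots> = (\<Sum>E\<in>F. a E * P E + b E)"
    using assms by (intro sum.cong) (auto simp: sum.distrib simp flip: sum_distrib_left)
  finally show ?thesis .
qed

lemma coherent_3P_imp_4P:
  assumes "\<Omega> \<noteq> {}" "\<E> \<subseteq> Pow \<Omega>" "coherent_3P \<Omega> \<E> P"
  shows "coherent_4P \<Omega> \<E> P"
  unfolding coherent_4P_def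
proof (intro allI impI)
  fix F and l :: "'a set \<Rightarrow> real" assume F: "finite F \<and> F \<noteq> {} \<and> F \<subseteq> \<E>"
  then have "F \<subseteq> Pow \<Omega>" "finite F" using assms(2) by auto
  note fin = atoms_finite_nonempty[OF assms(1) this]
  from F assms(3) obtain x where x: "\<And>E. E \<in> F \<Longrightarrow> (\<Sum>C\<in>atoms \<Omega> F. min_ind E C * x C) = P E"
    "sum x (atoms \<Omega> F) = 1" "\<And>C. C \<in> atoms \<Omega> F \<Longrightarrow> 0 \<le> x C"
    unfolding coherent_3P_def by metis
  have "(\<Sum>C\<in>atoms \<Omega> F. x C * (\<Sum>E\<in>F. l E * (min_ind E C - P E))) = 0"
    using average_affine[OF x(2,1), where a = l and b = "\<lambda>E. - l E * P E"]
    by (simp add: algebra_simps)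
  then have "\<exists>C\<in>atoms \<Omega> F. 0 \<le> (\<Sum>E\<in>F. l E * (min_ind E C - P E))"
    using x by (intro ex_nonneg_of_average_nonneg[OF fin(1)]) auto
  then show "0 \<le> (MAX C\<in>atoms \<Omega> F. \<Sum>E\<in>F. l E * (min_ind E C - P E))"
    using fin by (subst Max_ge_iff) auto
qed

lemma coherent_3P_imp_5P:
  assumes "\<Omega> \<noteq> {}" "\<E> \<subseteq> Pow \<Omega>" "coherent_3P \<Omega> \<E> P"
  shows "coherent_5P \<Omega> \<E> P"
  unfolding coherent_5P_def
proof (intro allI impI notI)
  fix F assume F: "finite F \<and> F \<noteq> {} \<and> F \<subseteq> \<E>"
  assume "\<exists>Q. Q \<in> F \<rightarrow> {0..1} \<and> (\<exists>E\<in>F. Q E \<noteq> P E) \<and>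
    (\<forall>C\<in>atoms \<Omega> F. quadratic_loss F Q C < quadratic_loss F P C)"
  then obtain Q where Q: "\<And>C. C \<in> atoms \<Omega> F \<Longrightarrow> quadratic_loss F Q C < quadratic_loss F P C"
    by auto
  have "F \<subseteq> Pow \<Omega>" "finite F" using assms(2) F by auto
  note fin = atoms_finite_nonempty[OF assms(1) this]
  from F assms(3) obtain x where x: "\<And>E. E \<in> F \<Longrightarrow> (\<Sum>C\<in>atoms \<Omega> F. min_ind E C * x C) = P E"
    "sum x (atoms \<Omega> F) = 1" "\<And>C. C \<in> atoms \<Omega> F \<Longrightarrow> 0 \<le> x C"
    unfolding coherent_3P_def by metis
  \<comment> \<open>The squares of \<open>min_ind E C\<close> cancel in the difference of the
    losses, leaving an affine function with these coefficients. Its mean is the squared distance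
    between \<open>P\<close> and \<open>Q\<close>.\<close>
  define a b where "a = (\<lambda>E. 2 * (P E - Q E))" and "b = (\<lambda>E. (Q E)\<^sup>2 - (P E)\<^sup>2)"
  have diff: "quadratic_loss F Q C - quadratic_loss F P C = (\<Sum>E\<in>F. a E * min_ind E C + b E)" for C
    unfolding quadratic_loss_def a_def b_def sum_subtractf[symmetric]
    by (intro sum.cong) (auto simp: power2_eq_square algebra_simps)
  have "(\<Sum>C\<in>atoms \<Omega> F. x C * (quadratic_loss F Q C - quadratic_loss F P C))
      = (\<Sum>E\<in>F. a E * P E + b E)"
    unfolding diff by (rule average_affine[OF x(2,1)])
  also have "\<dots> = (\<Sum>E\<in>F. (P E - Q E)\<^sup>2)"
    unfolding a_def b_def by (intro sum.cong) (auto simp: power2_eq_square algebra_simps)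
  also have "\<dots> \<ge> 0" by (simp add: sum_nonneg)
  finally have "\<exists>C\<in>atoms \<Omega> F. 0 \<le> quadratic_loss F Q C - quadratic_loss F P C"
    using x by (intro ex_nonneg_of_average_nonneg[OF fin(1)]) auto
  then show False using Q by force
qed

subsection \<open>Projection onto the finitely additive probabilities\<close>

text \<open>Values off \<open>Pow \<Omega>\<close> are confined to the unit interval as well, so
  that the set lies in a compact product over the whole type.\<close>

definition charges :: "'a set \<Rightarrow> ('a set \<Rightarrow> real) set" where
  "charges \<Omega> = {p. range p \<subseteq> {0..1} \<and> fin_add_prob \<Omega> (Pow \<Omega>) p}"

lemma dirac_in_charges: "\<omega> \<in> \<Omega> \<Longrightarrow> (\<lambda>A. indicat_real A \<omega>) \<in> charges \<Omega>"
  by (auto simp: charges_def fin_add_prob_def additive_def indicator_def)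

lemma charges_nonempty: "\<Omega> \<noteq> {} \<Longrightarrow> charges \<Omega> \<noteq> {}"
  using dirac_in_charges[of _ \<Omega>] by (metis all_not_in_conv)

lemma convex_combination_in_charges:
  assumes "p \<in> charges \<Omega>" "q \<in> charges \<Omega>" "0 \<le> t" "t \<le> 1"
  shows "(\<lambda>A. (1 - t) * p A + t * q A) \<in> charges \<Omega>"
proof -
  have "(1 - t) * p A + t * q A \<in> {0..1}" for A
  proof -
    have "p A \<in> {0..1}" "q A \<in> {0..1}" using assms unfolding charges_def by blast+
    then show ?thesis
      using convexD[of "{0..1::real}" "p A" "q A" "1 - t" t] assms by simp
  qed
  then show ?thesis
    using assms by (auto simp: charges_def fin_add_prob_def additive_def algebra_simps)
qed

text \<open>Tychonoff's theorem gives a compact cube; normalisation and each instance of additivity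
  are equations between continuous functions of finitely many coordinates, hence closed.\<close>

lemma compact_charges: "compact (charges \<Omega>)"
proof -
  have "compact (PiE UNIV (\<lambda>_::'a set. {0..1::real}))"
    using compactin_PiE[of "\<lambda>_::'a set. euclideanreal" UNIV "\<lambda>_. {0..1}"]
    by (simp add: euclidean_product_topology)
  moreover have "closed {p :: 'a set \<Rightarrow> real. p \<Omega> = 1 \<and>
      (\<forall>A B. A \<in> Pow \<Omega> \<and> B \<in> Pow \<Omega> \<and> A \<inter> B = {} \<longrightarrow> p (A \<union> B) = p A + p B)}" (is "closed ?C")
    by (intro closed_Collect_conj closed_Collect_all closed_Collect_imp closed_Collect_eq
        continuous_intros continuous_on_product_coordinates) simp
  ultimately have "compact (PiE UNIV (\<lambda>_::'a set. {0..1::real}) \<inter> ?C)"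
    by (rule compact_Int_closed)
  also have "PiE UNIV (\<lambda>_. {0..1}) \<inter> ?C = charges \<Omega>"
    unfolding charges_def fin_add_prob_def additive_def
    by (auto simp: PiE_def image_subset_iff)
  finally show ?thesis .
qed

text \<open>The variational inequality characterising the point \<open>q\<close> nearest to \<open>P\<close>, tested in
  the directions of the Dirac measures.\<close>

lemma ex_projection:
  assumes "\<Omega> \<noteq> {}" "finite F"
  shows "\<exists>q\<in>charges \<Omega>. \<forall>\<omega>\<in>\<Omega>. 0 \<le> (\<Sum>E\<in>F. (indicat_real E \<omega> - q E) * (q E - P E))"
proof -
  define D where "D q = (\<Sum>E\<in>F. (q E - P E)\<^sup>2)" for q :: "'a set \<Rightarrow> real"
  have "continuous_on (charges \<Omega>) D"
    unfolding D_def
    by (intro continuous_intros continuous_on_subset[OF continuous_on_product_coordinates]) simp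
  then obtain q where q: "q \<in> charges \<Omega>" and min: "\<And>r. r \<in> charges \<Omega> \<Longrightarrow> D q \<le> D r"
    using continuous_attains_inf[OF compact_charges charges_nonempty[OF assms(1)]] by blast
  have "0 \<le> (\<Sum>E\<in>F. (indicat_real E \<omega> - q E) * (q E - P E))" if "\<omega> \<in> \<Omega>" for \<omega>
  proof (rule ccontr)
    define a where "a = (\<Sum>E\<in>F. (indicat_real E \<omega> - q E) * (q E - P E))"
    define b where "b = (\<Sum>E\<in>F. (indicat_real E \<omega> - q E)\<^sup>2)"
    assume "\<not> ?thesis"
    then have a: "a < 0" by (simp add: a_def)
    have b: "0 \<le> b" by (simp add: b_def sum_nonneg)
    \<comment> \<open>Moving from \<open>q\<close> towards the Dirac measure by \<open>t\<close>
      changes the squared distance by \<open>2 * t * a + t\<^sup>2 * b\<close>. This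
      \<open>t\<close> makes it negative: \<open>t * b + t \<le> - a\<close> gives
      \<open>2 * a + t * b \<le> a - t\<close>. The summand 1 avoids division by zero, and the cap 1
      keeps the combination convex.\<close>
    define t where "t = min 1 (- a / (b + 1))"
    have t: "0 < t" "t \<le> 1" using a b by (auto simp: t_def intro: divide_neg_pos)
    have "t * (b + 1) \<le> - a"
      using b pos_le_divide_eq[of "b + 1" t "- a"] by (simp add: t_def)
    then have tb: "t * b + t \<le> - a" by (simp add: distrib_left)
    have "D q \<le> D (\<lambda>A. (1 - t) * q A + t * indicat_real A \<omega>)"
      using q t that by (intro min convex_combination_in_charges dirac_in_charges) auto
    also have "\<dots> = (\<Sum>E\<in>F. (q E - P E)\<^sup>2 + 2 * t * ((indicat_real E \<omega> - q E) * (q E - P E))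
        + t\<^sup>2 * (indicat_real E \<omega> - q E)\<^sup>2)"
      unfolding D_def by (intro sum.cong) (simp_all add: power2_eq_square algebra_simps)
    also have "\<dots> = D q + 2 * t * a + t\<^sup>2 * b"
      by (simp add: D_def a_def b_def sum.distrib sum_distrib_left)
    finally have "0 \<le> t * (2 * a + t * b)" by (simp add: power2_eq_square algebra_simps)
    then have "0 \<le> 2 * a + t * b" using t(1) by (simp add: zero_le_mult_iff)
    then show False using tb t(1) a by linarith
  qed
  then show ?thesis using q by blast
qed

section \<open>From finite families to the whole family\<close>

lemma coherent_1P_of_finite:
  assumes \<E>: "\<E> \<subseteq> Pow \<Omega>" and "\<Omega> \<noteq> {}"
    and fin: "\<And>F. finite F \<Longrightarrow> F \<noteq> {} \<Longrightarrow> F \<subseteq> \<E> \<Longrightarrow> \<exists>q\<in>charges \<Omega>. \<forall>E\<in>F. q E = P E"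
  shows "coherent_1P \<Omega> \<E> P"
proof -
  \<comment> \<open>Finite intersection property: each event imposes a closed condition, and
    finitely many are jointly satisfiable.\<close>
  have "charges \<Omega> \<inter> (\<Inter>E\<in>\<E>. {q. q E = P E}) \<noteq> {}"
  proof (rule compact_imp_fip_image[OF compact_charges])
    show "closed {q :: 'a set \<Rightarrow> real. q E = P E}" for E
      by (intro closed_Collect_eq continuous_on_product_coordinates continuous_on_const)
    show "charges \<Omega> \<inter> (\<Inter>E\<in>F. {q. q E = P E}) \<noteq> {}" if "finite F" "F \<subseteq> \<E>" for F
      using fin[OF that(1) _ that(2)] charges_nonempty[OF \<open>\<Omega> \<noteq> {}\<close>] by (cases "F = {}") auto
  qed
  then obtain p where p: "fin_add_prob \<Omega> (Pow \<Omega>) p" "\<And>E. E \<in> \<E> \<Longrightarrow> p E = P E"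
    by (auto simp: charges_def)
  have "gen_algebra \<Omega> \<E> \<subseteq> Pow \<Omega>" by (intro gen_algebra_minimal algebra_Pow \<E>)
  then show ?thesis
    unfolding coherent_1P_def using fin_add_prob_subset[OF p(1)] p(2) by metis
qed

lemma ex_charge_or_dominated:
  assumes "\<Omega> \<noteq> {}" "F \<subseteq> Pow \<Omega>" "finite F"
  obtains q where "q \<in> charges \<Omega>" "\<forall>E\<in>F. q E = P E"
  | q where "q \<in> charges \<Omega>" "\<exists>E\<in>F. q E \<noteq> P E"
      "\<And>C. C \<in> atoms \<Omega> F \<Longrightarrow> (\<Sum>E\<in>F. (P E - q E) * (min_ind E C - P E)) < 0"
      "\<And>C. C \<in> atoms \<Omega> F \<Longrightarrow> quadratic_loss F q C < quadratic_loss F P C"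
proof -
  from ex_projection[OF assms(1,3), of P] obtain q where q: "q \<in> charges \<Omega>"
    and proj: "\<And>\<omega>. \<omega> \<in> \<Omega> \<Longrightarrow> 0 \<le> (\<Sum>E\<in>F. (indicat_real E \<omega> - q E) * (q E - P E))"
    by blast
  show thesis
  proof (cases "\<forall>E\<in>F. q E = P E")
    case True
    then show thesis using q that(1) by blast
  next
    case False
    define d where "d = (\<Sum>E\<in>F. (q E - P E)\<^sup>2)"
    have "0 \<le> d" "d \<noteq> 0"
      using False assms(3) by (auto simp: d_def sum_nonneg sum_nonneg_eq_0_iff)
    then have d: "0 < d" by simp
    have atom: "0 \<le> (\<Sum>E\<in>F. (min_ind E C - q E) * (q E - P E))" (is "0 \<le> ?s C")
      if "C \<in> atoms \<Omega> F" for C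
    proof -
      have "C \<in> gen_algebra \<Omega> F" "C \<noteq> {}" using that by (auto simp: atoms_def)
      then obtain \<omega> where "\<omega> \<in> C" "\<omega> \<in> \<Omega>"
        using gen_algebra_minimal[OF algebra_Pow assms(2)] by blast
      then show ?thesis using proj[of \<omega>] min_ind_atom[OF assms(2) that] by simp
    qed
    \<comment> \<open>Expanding around \<open>q\<close>, with \<open>?s C\<close> the quantity
      bounded by the variational inequality and \<open>d\<close> the squared distance: the gain is
      \<open>- ?s C - d\<close>, and \<open>q\<close> improves the loss by
      \<open>2 * ?s C + d\<close>. Hence one \<open>q\<close> serves for both (iv) and (v).\<close>
    have bet: "(\<Sum>E\<in>F. (P E - q E) * (min_ind E C - P E)) = - ?s C - d" for C
      unfolding d_def sum_negf[symmetric] sum_subtractf[symmetric]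
      by (intro sum.cong) (simp_all add: power2_eq_square algebra_simps)
    have loss: "quadratic_loss F P C = quadratic_loss F q C + 2 * ?s C + d" for C
      unfolding d_def quadratic_loss_def sum_distrib_left sum.distrib[symmetric]
      by (intro sum.cong) (simp_all add: power2_eq_square algebra_simps)
    show thesis
    proof (rule that(2)[OF q])
      show "\<exists>E\<in>F. q E \<noteq> P E" using False by blast
      fix C assume "C \<in> atoms \<Omega> F"
      from atom[OF this] d show "(\<Sum>E\<in>F. (P E - q E) * (min_ind E C - P E)) < 0"
        and "quadratic_loss F q C < quadratic_loss F P C"
        unfolding bet loss by linarith+
    qed
  qed
qed

lemma coherent_4P_imp_1P:
  assumes "\<Omega> \<noteq> {}" "\<E> \<subseteq> Pow \<Omega>" "coherent_4P \<Omega> \<E> P"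
  shows "coherent_1P \<Omega> \<E> P"
proof (rule coherent_1P_of_finite[OF assms(2,1)])
  fix F assume F: "finite F" "F \<noteq> {}" "F \<subseteq> \<E>"
  then have F': "F \<subseteq> Pow \<Omega>" using assms(2) by auto
  note fin = atoms_finite_nonempty[OF assms(1) F' F(1)]
  show "\<exists>q\<in>charges \<Omega>. \<forall>E\<in>F. q E = P E"
  proof (rule ex_charge_or_dominated[OF assms(1) F' F(1)])
    fix q assume "\<And>C. C \<in> atoms \<Omega> F \<Longrightarrow> (\<Sum>E\<in>F. (P E - q E) * (min_ind E C - P E)) < 0"
    then have "(MAX C\<in>atoms \<Omega> F. \<Sum>E\<in>F. (P E - q E) * (min_ind E C - P E)) < 0"
      using fin by (subst Max_less_iff) auto
    moreover have "0 \<le> (MAX C\<in>atoms \<Omega> F. \<Sum>E\<in>F. (P E - q E) * (min_ind E C - P E))"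
      using assms(3)[unfolded coherent_4P_def, rule_format, of F "\<lambda>E. P E - q E"] F by blast
    ultimately show ?thesis by linarith
  qed blast
qed

lemma coherent_5P_imp_1P:
  assumes "\<Omega> \<noteq> {}" "\<E> \<subseteq> Pow \<Omega>" "coherent_5P \<Omega> \<E> P"
  shows "coherent_1P \<Omega> \<E> P"
proof (rule coherent_1P_of_finite[OF assms(2,1)])
  fix F assume F: "finite F" "F \<noteq> {}" "F \<subseteq> \<E>"
  then have F': "F \<subseteq> Pow \<Omega>" using assms(2) by auto
  show "\<exists>q\<in>charges \<Omega>. \<forall>E\<in>F. q E = P E"
  proof (rule ex_charge_or_dominated[OF assms(1) F' F(1)])
    fix q assume q: "q \<in> charges \<Omega>" "\<exists>E\<in>F. q E \<noteq> P E"
      "\<And>C. C \<in> atoms \<Omega> F \<Longrightarrow> quadratic_loss F q C < quadratic_loss F P C"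
    \<comment> \<open>Charges take values in the unit interval, so \<open>q\<close> is an admissible
      competitor to \<open>P\<close>.\<close>
    have "q \<in> F \<rightarrow> {0..1}" using q(1) by (auto simp: charges_def)
    then have "\<exists>Q. Q \<in> F \<rightarrow> {0..1} \<and> (\<exists>E\<in>F. Q E \<noteq> P E) \<and>
        (\<forall>C\<in>atoms \<Omega> F. quadratic_loss F Q C < quadratic_loss F P C)"
      using q(2,3) by (intro exI[of _ q]) simp
    then show ?thesis
      using assms(3)[unfolded coherent_5P_def, rule_format, of F] F by blast
  qed blast
qed

theorem corollary1:
  fixes \<Omega> :: "'a set" and \<E> :: "'a set set" and P :: "'a set \<Rightarrow> real"
  assumes "\<Omega> \<noteq> {}"
    and "\<E> \<subseteq> Pow \<Omega>"
    and "\<E> \<noteq> {}"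
    and "P \<in> \<E> \<rightarrow> {0..1}"
  shows "(coherent_1P \<Omega> \<E> P \<longleftrightarrow> coherent_2P \<Omega> \<E> P) \<and>
         (coherent_2P \<Omega> \<E> P \<longleftrightarrow> coherent_3P \<Omega> \<E> P) \<and>
         (coherent_3P \<Omega> \<E> P \<longleftrightarrow> coherent_4P \<Omega> \<E> P) \<and>
         (coherent_4P \<Omega> \<E> P \<longleftrightarrow> coherent_5P \<Omega> \<E> P)"
  \<comment> \<open>Besides (i) and (ii) being equivalent, there are two cycles through (i) and
    (iii), one via (iv) and one via (v).\<close>
  using assms coherent_1P_imp_2P[of \<E> \<Omega> P] coherent_2P_imp_1P[of \<Omega> \<E> P]
    coherent_1P_imp_3P[of \<E> \<Omega> P] coherent_3P_imp_4P[of \<Omega> \<E> P] coherent_3P_imp_5P[of \<Omega> \<E> P]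
    coherent_4P_imp_1P[of \<Omega> \<E> P] coherent_5P_imp_1P[of \<Omega> \<E> P]
  by blast

end
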